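(* Let $n$ be a positive integer and let $\mu=\{\mu_k\}_{k=0}^\infty$ be a sequence of complex numbers. Define $\gamma_k=\sum_{j=0}^{\lfloor k/2\rfloor}\binom{k}{j}\mu_{k-2j}$, the symmetric polynomial $W_{\mu,n}(z_1,\dots,z_n)=\sum_{0\le i\le j\le n}\mu_{j-i}e_i(\mathbf{z})e_j(\mathbf{z})$ (where $e_k$ is the $k$-th elementary symmetric polynomial in $z_1,\dots,z_n$), the polynomial $P_{\mu,n}(z)=\sum_{k=0}^n\gamma_k\binom{n}{k}z^{n-k}$, and the (non-linear) operator $T_\mu:\mathbb{C}[z]\to\mathbb{C}[z]$ by $$T_\mu\Big(\sum_{k=0}^n a_kz^k\Big)=\sum_{i\le j}\mu_{j-i}a_ia_jz^{i+j}.$$ The following are equivalent: (i) $W_{\mu,n}(\mathbf{z})$ is weakly Hurwitz stable; (ii) for all polynomials $P(z)$ of degree at most $n$ with only real and non-positive zeros, the polynomial $T_\mu(P(z))$ is either identically zero or weakly Hurwitz stable; (iii) $T_\mu((1+z)^n)=W_{\mu,n}(z,\dots,z)$ is weakly Hurwitz stable; (iv) the polynomial $P_{\mu,n}(z)$ is weakly Hurwitz stable.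
   Context: A complex polynomial $F(z_1,\dots,z_m)$ is weakly Hurwitz stable if $F(z_1,\dots,z_m)\neq 0$ whenever $\operatorname{Re}(z_j)>0$ for all $1\le j\le m$.
   Formalization: The equivalence of (ii) with the other conditions is stated only when some μ_k with 0≤k≤n is nonzero; if μ_0=…=μ_n=0, then (ii) holds trivially while W, T((1+z)^n) and P vanish identically and so are not weakly Hurwitz stable. *)

theory Defs
  imports Complex_Main "HOL-Computational_Algebra.Polynomial"
begin

text \<open>
  Polynomials in \<open>z\<^sub>1, \<dots>, z\<^sub>m\<close> are represented by their evaluation functions on
  \<open>nat \<Rightarrow> complex\<close>, where only the arguments with index in \<open>{1..m}\<close> are used.
  The zero polynomial is not stable.
\<close>

definition weakly_hurwitz_stable :: "nat \<Rightarrow> ((nat \<Rightarrow> complex) \<Rightarrow> complex) \<Rightarrow> bool" where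
  "weakly_hurwitz_stable m F \<longleftrightarrow> (\<forall>z. (\<forall>j\<in>{1..m}. Re (z j) > 0) \<longrightarrow> F z \<noteq> 0)"

definition weakly_hurwitz_stable_poly :: "complex poly \<Rightarrow> bool" where
  "weakly_hurwitz_stable_poly p \<longleftrightarrow> weakly_hurwitz_stable 1 (\<lambda>z. poly p (z 1))"

definition elem_sym :: "nat \<Rightarrow> nat \<Rightarrow> (nat \<Rightarrow> complex) \<Rightarrow> complex" where
  "elem_sym n k z = (\<Sum>S | S \<subseteq> {1..n} \<and> card S = k. \<Prod>j\<in>S. z j)"

definition gamma_seq :: "(nat \<Rightarrow> complex) \<Rightarrow> nat \<Rightarrow> complex" where
  "gamma_seq \<mu> k = (\<Sum>j = 0..k div 2. of_nat (k choose j) * \<mu> (k - 2 * j))"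

definition W_fun :: "(nat \<Rightarrow> complex) \<Rightarrow> nat \<Rightarrow> (nat \<Rightarrow> complex) \<Rightarrow> complex" where
  "W_fun \<mu> n z = (\<Sum>j = 0..n. \<Sum>i = 0..j. \<mu> (j - i) * elem_sym n i z * elem_sym n j z)"

definition P_poly :: "(nat \<Rightarrow> complex) \<Rightarrow> nat \<Rightarrow> complex poly" where
  "P_poly \<mu> n = (\<Sum>k = 0..n. monom (gamma_seq \<mu> k * of_nat (n choose k)) (n - k))"

text \<open>
  Any upper bound at least \<open>degree p\<close> for \<open>j\<close> gives the same sum, since the further
  coefficients of \<open>p\<close> vanish.
\<close>

definition T_op :: "(nat \<Rightarrow> complex) \<Rightarrow> complex poly \<Rightarrow> complex poly" where
  "T_op \<mu> p =
     (\<Sum>j = 0..degree p. \<Sum>i = 0..j. monom (\<mu> (j - i) * coeff p i * coeff p j) (i + j))"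

end

theory Submission
  imports Defs "HOL-Complex_Analysis.Great_Picard"
    "HOL-Computational_Algebra.Fundamental_Theorem_Algebra"
begin

text \<open>
  Dividing \<open>W\<close> by \<open>z\<^sub>1 \<cdots> z\<^sub>n\<close> gives \<open>\<Sum>k\<le>n. \<gamma>\<^sub>k e\<^bsub>n-k\<^esub>(z\<^sub>1 + 1/z\<^sub>1, \<dots>, z\<^sub>n + 1/z\<^sub>n)\<close>, the polarization of
  \<open>P\<close> at the points \<open>z\<^sub>j + 1/z\<^sub>j\<close>. Since \<open>z \<mapsto> z + 1/z\<close> maps the right half plane onto itself, stability
  on the diagonal is stability of \<open>P\<close>, and the Grace-Walsh-Szego theorem passes from \<open>P\<close> to its
  polarization. For positive \<open>a\<^sub>j\<close> and \<open>b\<^sub>j\<close>, applying \<open>T\<close> to \<open>\<Prod>(a\<^sub>j + b\<^sub>j t)\<close> amounts to evaluating \<open>W\<close> at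
  \<open>(b\<^sub>j/a\<^sub>j) z\<close>; every polynomial with non-positive zeros and degree at most \<open>n\<close> is a limit of such
  products, and Hurwitz's theorem applies to the limit.
\<close>

section \<open>Polarization and the Grace-Walsh-Szego theorem\<close>

text \<open>This is \<open>P_poly\<close> for an arbitrary sequence; the inductions below replace
  \<open>c\<close> by its shift and by combinations of the two.\<close>

definition binomial_poly :: "nat \<Rightarrow> (nat \<Rightarrow> complex) \<Rightarrow> complex poly" where
  "binomial_poly n c = (\<Sum>k = 0..n. monom (c k * of_nat (n choose k)) (n - k))"

text \<open>
  This is \<open>\<Sum>k\<le>n. c k * e\<^bsub>n-k\<^esub>(w\<^sub>1, \<dots>, w\<^sub>n)\<close>, evaluated by splitting off the last variable.
\<close>

fun polarization :: "nat \<Rightarrow> (nat \<Rightarrow> complex) \<Rightarrow> (nat \<Rightarrow> complex) \<Rightarrow> complex" where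
  "polarization 0 c w = c 0"
| "polarization (Suc n) c w = polarization n (\<lambda>k. w (Suc n) * c k + c (Suc k)) w"

section \<open>Recursion, linearity and derivative of \<open>binomial_poly\<close>\<close>

lemma binomial_poly_0: "binomial_poly 0 c = [:c 0:]"
  by (simp add: binomial_poly_def monom_0)

lemma poly_binomial_poly:
  "poly (binomial_poly n c) x = (\<Sum>k = 0..n. c k * of_nat (n choose k) * x ^ (n - k))"
  by (simp add: binomial_poly_def poly_sum poly_monom)

text \<open>Pascal's rule: the part with \<open>n choose Suc k\<close> joins the leading term to
  form the first summand, the part with \<open>n choose k\<close> belongs to the shifted
  sequence.\<close>

lemma poly_binomial_poly_Suc:
  "poly (binomial_poly (Suc n) c) x
     = x * poly (binomial_poly n c) x + poly (binomial_poly n (\<lambda>k. c (Suc k))) x"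
proof -
  have "poly (binomial_poly (Suc n) c) x
      = c 0 * x ^ Suc n + (\<Sum>k = 0..n. c (Suc k) * of_nat (Suc n choose Suc k) * x ^ (n - k))"
    unfolding poly_binomial_poly by (subst sum.atLeast0_atMost_Suc_shift) simp
  also have "(\<Sum>k = 0..n. c (Suc k) * of_nat (Suc n choose Suc k) * x ^ (n - k))
      = (\<Sum>k = 0..n. c (Suc k) * of_nat (n choose Suc k) * x ^ (n - k))
        + poly (binomial_poly n (\<lambda>k. c (Suc k))) x"
    unfolding poly_binomial_poly by (simp add: sum.distrib[symmetric] algebra_simps)
  also have "c 0 * x ^ Suc n + (\<dots>) = (c 0 * x ^ Suc n
      + (\<Sum>k = 0..n. c (Suc k) * of_nat (n choose Suc k) * x ^ (n - k)))
      + poly (binomial_poly n (\<lambda>k. c (Suc k))) x"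
    by (rule add.assoc [symmetric])
  also have "c 0 * x ^ Suc n + (\<Sum>k = 0..n. c (Suc k) * of_nat (n choose Suc k) * x ^ (n - k))
      = (\<Sum>k = 0..Suc n. c k * of_nat (n choose k) * x ^ (Suc n - k))"
    unfolding sum.atLeast0_atMost_Suc_shift by simp
  \<comment> \<open>The term \<open>k = Suc n\<close> drops out because
    \<open>n choose Suc n = 0\<close>; every other term has a spare factor \<open>x\<close>.\<close>
  also have "\<dots> = x * poly (binomial_poly n c) x"
    unfolding poly_binomial_poly sum_distrib_left
    by (simp add: Suc_diff_le algebra_simps cong: sum.cong_simp)
  finally show ?thesis .
qed

lemma binomial_poly_Suc:
  "binomial_poly (Suc n) c
     = [:0, 1:] * binomial_poly n c + binomial_poly n (\<lambda>k. c (Suc k))"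
  by (simp add: poly_eq_poly_eq_iff [symmetric] fun_eq_iff poly_binomial_poly_Suc)

lemma poly_binomial_poly_add_scale:
  "poly (binomial_poly n (\<lambda>k. a * c k + d k)) x
     = a * poly (binomial_poly n c) x + poly (binomial_poly n d) x"
  by (simp add: poly_binomial_poly sum.distrib[symmetric] sum_distrib_left algebra_simps)

text \<open>The Appell property: differentiation lowers the formal degree and keeps
  \<open>c\<close>. This makes polar derivatives easy to express.\<close>

lemma pderiv_binomial_poly:
  "pderiv (binomial_poly (Suc n) c) = smult (of_nat (Suc n)) (binomial_poly n c)"
proof (induction n arbitrary: c)
  case 0
  show ?case
    by (simp add: binomial_poly_Suc binomial_poly_0 pderiv_add pderiv_mult pderiv_pCons)
next
  case (Suc n)
  have "pderiv (binomial_poly (Suc (Suc n)) c)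
      = binomial_poly (Suc n) c + [:0, 1:] * pderiv (binomial_poly (Suc n) c)
        + pderiv (binomial_poly (Suc n) (\<lambda>k. c (Suc k)))"
    by (subst binomial_poly_Suc) (simp add: pderiv_add pderiv_mult pderiv_pCons)
  also have "\<dots> = binomial_poly (Suc n) c + smult (of_nat (Suc n))
      ([:0, 1:] * binomial_poly n c + binomial_poly n (\<lambda>k. c (Suc k)))"
    unfolding Suc.IH by (simp only: mult_smult_right smult_add_right add.assoc)
  also have "\<dots> = smult (of_nat (Suc (Suc n))) (binomial_poly (Suc n) c)"
    unfolding binomial_poly_Suc [of n c, symmetric]
    by (simp only: of_nat_Suc [of "Suc n"] smult_add_left smult_1_left)
  finally show ?case .
qed

lemma degree_binomial_poly: "degree (binomial_poly n c) \<le> n"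
  unfolding binomial_poly_def
  by (intro degree_sum_le) (auto intro: order.trans [OF degree_monom_le])

text \<open>Both sides obey the same recursion in \<open>n\<close>.\<close>

lemma polarization_diagonal: "polarization n c (\<lambda>_. x) = poly (binomial_poly n c) x"
  by (induction n arbitrary: c)
     (simp_all add: binomial_poly_0 poly_binomial_poly_Suc poly_binomial_poly_add_scale)

lemma polarization_scale: "polarization n (\<lambda>k. t * c k) w = t * polarization n c w"
proof (induction n arbitrary: c)
  case (Suc n)
  show ?case
    using Suc.IH [of "\<lambda>k. w (Suc n) * c k + c (Suc k)"] by (simp add: algebra_simps)
qed simp

text \<open>
  \<open>\<zeta> \<mapsto> 1 / (w - \<zeta>)\<close> maps the closed left half plane into the closed disc with diameter
  \<open>[0, 1 / Re w]\<close> and the open right half plane into its complement.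
\<close>

lemma norm_inverse_diff_le_iff:
  fixes w \<zeta> :: complex
  assumes "Re w > 0" "w \<noteq> \<zeta>"
  shows "norm (1 / (w - \<zeta>) - of_real (1 / (2 * Re w))) \<le> 1 / (2 * Re w) \<longleftrightarrow> Re \<zeta> \<le> 0"
proof -
  define v where "v = w - \<zeta>"
  have v: "v \<noteq> 0" and vz: "Re \<zeta> = Re w - Re v"
    using assms by (simp_all add: v_def)
  define N where "N = (Re v)\<^sup>2 + (Im v)\<^sup>2"
  have N: "N > 0"
    using v unfolding N_def complex_eq_iff by (simp add: sum_power2_gt_zero_iff)
  define r where "r = 1 / (2 * Re w)"
  have r: "r > 0" using assms by (simp add: r_def)
  \<comment> \<open>Comparing squares cancels the square of \<open>r\<close> and leaves only the
    sign of \<open>1 - 2 * r * Re v\<close>.\<close>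
  have "norm (1 / v - of_real r) \<le> r \<longleftrightarrow> (norm (1 / v - of_real r))\<^sup>2 \<le> r\<^sup>2"
    using r by (auto simp: abs_le_square_iff [symmetric])
  also have "(norm (1 / v - of_real r))\<^sup>2 = (Re v / N - r)\<^sup>2 + (Im v / N)\<^sup>2"
    by (simp add: cmod_power2 N_def Re_divide Im_divide)
  also have "\<dots> = ((Re v)\<^sup>2 + (Im v)\<^sup>2) / N\<^sup>2 - 2 * r * Re v / N + r\<^sup>2"
    by (simp add: power2_diff power_divide add_divide_distrib algebra_simps)
  also have "\<dots> = (1 - 2 * r * Re v) / N + r\<^sup>2"
    unfolding N_def [symmetric] using N by (simp add: power2_eq_square diff_divide_distrib)
  also have "\<dots> \<le> r\<^sup>2 \<longleftrightarrow> 1 \<le> 2 * r * Re v"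
    using N by (simp add: divide_le_0_iff)
  also have "\<dots> \<longleftrightarrow> Re \<zeta> \<le> 0"
    using assms(1) by (simp add: r_def vz field_simps)
  finally show ?thesis by (simp add: v_def r_def)
qed

text \<open>The logarithmic derivative is the sum of \<open>1 / (w - \<zeta>)\<close> over the
  zeros, and each summand lies in the disc with centre and radius \<open>1 / (2 * Re w)\<close>. The
  induction splits off one zero at a time.\<close>

lemma log_derivative_in_disc:
  fixes p :: "complex poly"
  assumes "\<And>x. Re x > 0 \<Longrightarrow> poly p x \<noteq> 0" "Re w > 0"
  shows "norm (poly (pderiv p) w / poly p w - of_nat (degree p) * of_real (1 / (2 * Re w)))
           \<le> of_nat (degree p) * (1 / (2 * Re w))"
  using assms(1)
proof (induction "degree p" arbitrary: p)
  case 0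
  then obtain a where "p = [:a:]"
    using degree_eq_zeroE by metis
  then show ?case by (simp add: pderiv_pCons)
next
  case (Suc d)
  then have "\<not> constant (poly p)"
    by (simp add: constant_degree)
  then obtain \<zeta> where "poly p \<zeta> = 0"
    using fundamental_theorem_of_algebra by blast
  then obtain q where q: "p = [:- \<zeta>, 1:] * q"
    by (metis poly_eq_0_iff_dvd dvdE)
  have p0: "poly p w \<noteq> 0"
    using Suc.prems assms(2) by blast
  have \<zeta>: "Re \<zeta> \<le> 0"
    using Suc.prems \<open>poly p \<zeta> = 0\<close> by (meson not_less)
  have w\<zeta>: "w \<noteq> \<zeta>" and q0: "poly q w \<noteq> 0"
    using p0 q by auto
  then have "q \<noteq> 0" by auto
  then have "degree p = degree [:- \<zeta>, 1:] + degree q"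
    unfolding q by (intro degree_mult_eq) auto
  with Suc.hyps(2) have dq: "d = degree q" by simp
  have qroots: "poly q x \<noteq> 0" if "Re x > 0" for x
    using Suc.prems [OF that] q by auto
  let ?r = "1 / (2 * Re w)"
  have "poly (pderiv p) w / poly p w = 1 / (w - \<zeta>) + poly (pderiv q) w / poly q w"
  proof -
    have "poly p w = (w - \<zeta>) * poly q w"
      by (simp add: q algebra_simps)
    moreover have "poly (pderiv p) w = (w - \<zeta>) * poly (pderiv q) w + poly q w"
      unfolding q pderiv_mult by (simp add: pderiv_pCons algebra_simps)
    ultimately have "poly (pderiv p) w / poly p w
        = ((w - \<zeta>) * poly (pderiv q) w + poly q w) / ((w - \<zeta>) * poly q w)"
      by simp
    also have "\<dots> = 1 / (w - \<zeta>) + poly (pderiv q) w / poly q w"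
      using w\<zeta> q0 by (simp add: add_divide_distrib)
    finally show ?thesis .
  qed
  then have "poly (pderiv p) w / poly p w - of_nat (Suc d) * of_real ?r
      = (1 / (w - \<zeta>) - of_real ?r)
        + (poly (pderiv q) w / poly q w - of_nat (degree q) * of_real ?r)"
    by (simp add: dq algebra_simps add_divide_distrib)
  also have "norm \<dots> \<le> ?r + of_nat (degree q) * ?r"
    using norm_inverse_diff_le_iff [OF assms(2) w\<zeta>] \<zeta> Suc.hyps(1) [OF dq qroots]
    by (intro norm_triangle_le add_mono) auto
  also have "\<dots> = of_nat (Suc d) * ?r"
    by (simp add: dq algebra_simps add_divide_distrib)
  finally show ?case
    using Suc.hyps(2) by simp
qed

text \<open>Laguerre's theorem on polar derivatives, with a formal degree that may exceed the degree.\<close>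

lemma polar_derivative_nonzero:
  fixes p :: "complex poly"
  assumes "\<And>x. Re x > 0 \<Longrightarrow> poly p x \<noteq> 0" "degree p \<le> m" "m > 0" "Re w > 0" "Re x > 0"
  shows "of_nat m * poly p x + (w - x) * poly (pderiv p) x \<noteq> 0"
proof
  assume eq: "of_nat m * poly p x + (w - x) * poly (pderiv p) x = 0"
  define r where "r = 1 / (2 * Re x)"
  define u where "u = poly (pderiv p) x / poly p x"
  have px: "poly p x \<noteq> 0" using assms by auto
  then have xw: "x \<noteq> w" using eq \<open>m > 0\<close> by auto
  \<comment> \<open>At a zero of the polar derivative, the logarithmic derivative is what it would
    be if all \<open>m\<close> zeros sat at \<open>w\<close>.\<close>
  have u: "u = of_nat m * (1 / (x - w))"
    using eq px xw by (simp add: u_def field_simps)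
  \<comment> \<open>The discs with centre and radius \<open>d * r\<close> touch at 0 and are nested
    in \<open>d\<close>, so the bound passes from \<open>degree p\<close> to the formal degree
    \<open>m\<close>.\<close>
  have "norm (u - of_nat m * of_real r)
      \<le> norm (u - of_nat (degree p) * of_real r) + norm (of_nat (m - degree p) * complex_of_real r)"
    using norm_triangle_ineq4 [of "u - of_nat (degree p) * of_real r"] assms(2)
    by (metis (no_types, lifting) diff_diff_eq distrib_right le_add_diff_inverse of_nat_add)
  also have "\<dots> \<le> of_nat (degree p) * r + of_nat (m - degree p) * r"
    using log_derivative_in_disc [OF assms(1) assms(5)] assms(5)
    by (intro add_mono) (auto simp: u_def r_def norm_mult norm_divide)
  also have "\<dots> = of_nat m * r"
    using assms(2) by (simp add: of_nat_diff algebra_simps)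
  finally have "norm (of_nat m * (1 / (x - w) - complex_of_real r)) \<le> of_nat m * r"
    by (simp add: u algebra_simps)
  then have "norm (1 / (x - w) - complex_of_real r) \<le> r"
    using \<open>m > 0\<close> by (simp add: norm_mult)
  then show False
    using norm_inverse_diff_le_iff [OF assms(5) xw] assms(4) by (simp add: r_def)
qed

text \<open>Fixing the last variable amounts to taking a polar derivative with that pole. By
  Laguerre it has no zero in the half plane, and the induction goes on with the remaining
  variables.\<close>

theorem Grace_Walsh_Szego_right_half_plane:
  assumes "\<And>x. Re x > 0 \<Longrightarrow> poly (binomial_poly n c) x \<noteq> 0" "\<And>j. j \<in> {1..n} \<Longrightarrow> Re (w j) > 0"
  shows "polarization n c w \<noteq> 0"
  using assms
proof (induction n arbitrary: c)
  case 0
  then show ?case using "0.prems"(1) [of 1] by (simp add: binomial_poly_0)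
next
  case (Suc n)
  let ?c = "\<lambda>k. w (Suc n) * c k + c (Suc k)"
  have "poly (binomial_poly n ?c) x \<noteq> 0" if x: "Re x > 0" for x
  proof -
    have "of_nat (Suc n) * poly (binomial_poly n ?c) x
        = of_nat (Suc n) * poly (binomial_poly (Suc n) c) x
          + (w (Suc n) - x) * poly (pderiv (binomial_poly (Suc n) c)) x"
      by (simp only: pderiv_binomial_poly poly_binomial_poly_Suc poly_binomial_poly_add_scale
          poly_smult) (simp add: algebra_simps)
    also have "\<dots> \<noteq> 0"
      using Suc.prems x degree_binomial_poly by (intro polar_derivative_nonzero) auto
    finally show ?thesis by auto
  qed
  then show ?case
    using Suc.IH [of ?c] Suc.prems(2) by simp
qed

section \<open>The quadratic form behind \<open>W\<close> and \<open>T\<close>\<close>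

text \<open>Extension by zero turns the sum over \<open>i \<le> j\<close> into a full Toeplitz sum
  and lets the index shift without boundary cases.\<close>

definition zero_extend :: "(nat \<Rightarrow> complex) \<Rightarrow> int \<Rightarrow> complex" where
  "zero_extend \<mu> k = (if k < 0 then 0 else \<mu> (nat k))"

definition neighbour_sum :: "(int \<Rightarrow> complex) \<Rightarrow> int \<Rightarrow> complex" where
  "neighbour_sum \<nu> k = \<nu> (k + 1) + \<nu> (k - 1)"

text \<open>A Toeplitz quadratic form in the coefficients of \<open>p\<close>. Its size
  \<open>n\<close> is kept apart from \<open>degree p\<close>, which may be smaller.\<close>

definition coeff_form :: "nat \<Rightarrow> (int \<Rightarrow> complex) \<Rightarrow> complex poly \<Rightarrow> complex" where
  "coeff_form n \<nu> p = (\<Sum>j = 0..n. (\<Sum>i = 0..n. \<nu> (int j - int i) * coeff p i) * coeff p j)"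

text \<open>The transpose of multiplication by \<open>a + b t\<close>: the linear factor moves from
  the coefficients to the weights \<open>g\<close>.\<close>

lemma sum_coeff_linear_mult:
  fixes p :: "complex poly"
  assumes "degree p \<le> n"
  shows "(\<Sum>i = 0..Suc n. g i * coeff ([:a, b:] * p) i)
      = (\<Sum>i = 0..n. (a * g i + b * g (Suc i)) * coeff p i)"
proof -
  have top: "coeff p (Suc n) = 0"
    using assms by (simp add: coeff_eq_0)
  have "(\<Sum>i = 0..Suc n. g i * coeff ([:a, b:] * p) i)
      = (\<Sum>i = 0..Suc n. a * (g i * coeff p i)) + (\<Sum>i = 0..Suc n. g i * coeff (pCons 0 (smult b p)) i)"
    by (simp add: sum.distrib [symmetric] algebra_simps del: sum.atLeast0_atMost_Suc)
  also have "(\<Sum>i = 0..Suc n. a * (g i * coeff p i)) = (\<Sum>i = 0..n. a * (g i * coeff p i))"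
    by (simp add: top)
  also have "(\<Sum>i = 0..Suc n. g i * coeff (pCons 0 (smult b p)) i)
      = (\<Sum>i = 0..n. b * (g (Suc i) * coeff p i))"
    unfolding sum.atLeast0_atMost_Suc_shift by (simp add: mult_ac)
  finally show ?thesis
    by (simp add: sum.distrib algebra_simps)
qed

text \<open>Transposing in both indices gives four terms. As \<open>\<nu>\<close> is taken at
  \<open>j - i\<close>, the two square terms keep the index and the two mixed terms shift it by
  \<open>1\<close> and \<open>-1\<close>.\<close>

lemma coeff_form_linear_mult:
  assumes "degree p \<le> n"
  shows "coeff_form (Suc n) \<nu> ([:a, b:] * p)
      = coeff_form n (\<lambda>k. (a\<^sup>2 + b\<^sup>2) * \<nu> k + a * b * neighbour_sum \<nu> k) p"
proof -
  define f where "f j i = \<nu> (int j - int i)" for j i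
  have "coeff_form (Suc n) \<nu> ([:a, b:] * p)
      = (\<Sum>j = 0..Suc n. (\<Sum>i = 0..n. (a * f j i + b * f j (Suc i)) * coeff p i)
          * coeff ([:a, b:] * p) j)"
    unfolding coeff_form_def f_def [symmetric] sum_coeff_linear_mult [OF assms] ..
  also have "\<dots> = (\<Sum>j = 0..n. (a * (\<Sum>i = 0..n. (a * f j i + b * f j (Suc i)) * coeff p i)
      + b * (\<Sum>i = 0..n. (a * f (Suc j) i + b * f (Suc j) (Suc i)) * coeff p i)) * coeff p j)"
    by (rule sum_coeff_linear_mult [OF assms])
  also have "\<dots> = coeff_form n (\<lambda>k. (a\<^sup>2 + b\<^sup>2) * \<nu> k + a * b * neighbour_sum \<nu> k) p"
  proof -
    have "a * ((a * f j i + b * f j (Suc i)) * c) + b * ((a * f (Suc j) i + b * f (Suc j) (Suc i)) * c)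
        = ((a\<^sup>2 + b\<^sup>2) * \<nu> (int j - int i) + a * b * neighbour_sum \<nu> (int j - int i)) * c" for i j c
    proof -
      have "f (Suc j) (Suc i) = f j i" "f (Suc j) i = \<nu> (int j - int i + 1)"
        "f j (Suc i) = \<nu> (int j - int i - 1)"
        by (simp_all add: f_def algebra_simps)
      then show ?thesis
        by (simp add: neighbour_sum_def f_def power2_eq_square algebra_simps)
    qed
    then show ?thesis
      by (simp add: coeff_form_def sum_distrib_left sum.distrib [symmetric])
  qed
  finally show ?thesis .
qed

lemma funpow_neighbour_sum_lin:
  "(neighbour_sum ^^ k) (\<lambda>m. s * \<nu> m + t * \<nu>' m)
     = (\<lambda>m. s * (neighbour_sum ^^ k) \<nu> m + t * (neighbour_sum ^^ k) \<nu>' m)"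
  by (induction k) (simp_all add: neighbour_sum_def fun_eq_iff algebra_simps)

lemma degree_prod_linear_le:
  fixes a b :: "nat \<Rightarrow> complex"
  shows "degree (\<Prod>j = 1..n. [:a j, b j:]) \<le> n"
proof -
  have "degree (\<Prod>j = 1..n. [:a j, b j:]) \<le> (\<Sum>j = 1..n. degree [:a j, b j:])"
    using degree_prod_sum_le [of "{1..n}" "\<lambda>j. [:a j, b j:]"] by (simp add: comp_def)
  also have "\<dots> \<le> (\<Sum>j = 1..n. 1)"
    by (intro sum_mono) simp
  finally show ?thesis by simp
qed

text \<open>
  Multiplying \<open>p\<close> by \<open>1 + z t\<close> acts on \<open>\<nu>\<close> as \<open>z (z + 1/z + A)\<close> with \<open>A = neighbour_sum\<close>, so the
  form at \<open>\<Prod>(1 + z\<^sub>j t)\<close> is \<open>\<Prod>z\<^sub>j\<close> times the polarization of \<open>k \<mapsto> (A\<^sup>k \<nu>) 0\<close> at the points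
  \<open>z\<^sub>j + 1/z\<^sub>j\<close>.
\<close>

lemma coeff_form_prod:
  assumes "\<And>j. j \<in> {1..n} \<Longrightarrow> z j \<noteq> 0"
  shows "coeff_form n \<nu> (\<Prod>j = 1..n. [:1, z j:])
      = (\<Prod>j = 1..n. z j)
        * polarization n (\<lambda>k. (neighbour_sum ^^ k) \<nu> 0) (\<lambda>j. z j + 1 / z j)"
  using assms
proof (induction n arbitrary: \<nu>)
  case 0
  show ?case by (simp add: coeff_form_def)
next
  case (Suc n)
  define x where "x = z (Suc n)"
  have x: "x \<noteq> 0" using Suc.prems by (simp add: x_def)
  let ?c = "\<lambda>k. (neighbour_sum ^^ k) \<nu> 0"
  \<comment> \<open>Writing \<open>1 + x^2\<close> as \<open>x * (x + 1 / x)\<close> and pulling out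
    \<open>x\<close> leaves exactly the recursion of \<open>polarization\<close>.\<close>
  have c: "(neighbour_sum ^^ k) (\<lambda>k. (1\<^sup>2 + x\<^sup>2) * \<nu> k + 1 * x * neighbour_sum \<nu> k) 0
      = x * ((x + 1 / x) * ?c k + ?c (Suc k))" for k
    unfolding funpow_neighbour_sum_lin using x
    by (simp add: funpow_swap1 power2_eq_square field_simps)
  have "coeff_form (Suc n) \<nu> (\<Prod>j = 1..Suc n. [:1, z j:])
      = coeff_form (Suc n) \<nu> ([:1, x:] * (\<Prod>j = 1..n. [:1, z j:]))"
    by (simp add: x_def)
  also have "\<dots> = coeff_form n (\<lambda>k. (1\<^sup>2 + x\<^sup>2) * \<nu> k + 1 * x * neighbour_sum \<nu> k) (\<Prod>j = 1..n. [:1, z j:])"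
    by (rule coeff_form_linear_mult [OF degree_prod_linear_le])
  also have "\<dots> = (\<Prod>j = 1..n. z j)
      * polarization n (\<lambda>k. x * ((x + 1 / x) * ?c k + ?c (Suc k))) (\<lambda>j. z j + 1 / z j)"
    unfolding c [symmetric] by (rule Suc.IH) (use Suc.prems in auto)
  also have "\<dots> = (\<Prod>j = 1..Suc n. z j) * polarization (Suc n) ?c (\<lambda>j. z j + 1 / z j)"
    by (simp only: polarization_scale polarization.simps x_def) simp
  finally show ?case .
qed

text \<open>Binomial expansion of a power of the sum of the two unit shifts, which are inverse to
  each other.\<close>

lemma funpow_neighbour_sum:
  "(neighbour_sum ^^ k) \<nu> m = (\<Sum>j = 0..k. of_nat (k choose j) * \<nu> (m + int k - 2 * int j))"
proof (induction k arbitrary: m)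
  case 0
  show ?case by simp
next
  case (Suc k)
  define f where "f j = \<nu> (m + int (Suc k) - 2 * int j)" for j
  have "(\<Sum>j = 0..Suc k. of_nat (Suc k choose j) * f j)
      = f 0 + (\<Sum>j = 0..k. of_nat (k choose Suc j) * f (Suc j)) + (\<Sum>j = 0..k. of_nat (k choose j) * f (Suc j))"
    unfolding sum.atLeast0_atMost_Suc_shift by (simp add: sum.distrib algebra_simps)
  also have "f 0 + (\<Sum>j = 0..k. of_nat (k choose Suc j) * f (Suc j))
      = (\<Sum>j = 0..Suc k. of_nat (k choose j) * f j)"
    unfolding sum.atLeast0_atMost_Suc_shift by simp
  also have "\<dots> = (\<Sum>j = 0..k. of_nat (k choose j) * f j)"
    by simp
  also have "(\<Sum>j = 0..k. of_nat (k choose j) * f j) + (\<Sum>j = 0..k. of_nat (k choose j) * f (Suc j))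
      = (neighbour_sum ^^ Suc k) \<nu> m"
    by (simp add: neighbour_sum_def Suc.IH f_def algebra_simps)
  finally show ?case by (simp add: f_def)
qed

text \<open>The terms with \<open>2 * j > k\<close> fall on negative indices, where the extension is
  0; hence the cut-off at \<open>k div 2\<close>.\<close>

lemma gamma_seq_eq_funpow: "gamma_seq \<mu> k = (neighbour_sum ^^ k) (zero_extend \<mu>) 0"
proof -
  have "(neighbour_sum ^^ k) (zero_extend \<mu>) 0
      = (\<Sum>j = 0..k. of_nat (k choose j) * zero_extend \<mu> (int k - 2 * int j))"
    by (simp add: funpow_neighbour_sum)
  also have "\<dots> = (\<Sum>j = 0..k div 2. of_nat (k choose j) * zero_extend \<mu> (int k - 2 * int j))"
    by (intro sum.mono_neutral_right) (auto simp: zero_extend_def)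
  also have "\<dots> = gamma_seq \<mu> k"
    unfolding gamma_seq_def
    by (intro sum.cong refl) (auto simp: zero_extend_def nat_diff_distrib nat_mult_distrib)
  finally show ?thesis ..
qed

section \<open>Translation of P, W and T into the quadratic form and its polarization\<close>

lemma P_poly_eq_binomial_poly: "P_poly \<mu> n = binomial_poly n (gamma_seq \<mu>)"
  by (simp add: P_poly_def binomial_poly_def)

lemma coeff_prod_linear:
  "coeff (\<Prod>j = 1..n. [:1, z j:]) k = elem_sym n k z"
proof -
  have "(\<Prod>j = 1..n. [:1, z j:]) = (\<Prod>j = 1..n. monom (z j) 1 + 1)"
    by (simp add: monom_altdef one_pCons)
  also have "\<dots> = (\<Sum>S\<in>Pow {1..n}. \<Prod>j\<in>S. monom (z j) 1)"
    by (simp add: prod_add)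
  also have "\<dots> = (\<Sum>S\<in>Pow {1..n}. monom (\<Prod>j\<in>S. z j) (card S))"
  proof (intro sum.cong refl)
    fix S assume "S \<in> Pow {1..n}"
    then have "finite S" using finite_subset by auto
    then show "(\<Prod>j\<in>S. monom (z j) 1) = monom (\<Prod>j\<in>S. z j) (card S)"
      by (induction S) (simp_all add: mult_monom monom_eq_1)
  qed
  finally have "coeff (\<Prod>j = 1..n. [:1, z j:]) k
      = (\<Sum>S\<in>Pow {1..n}. if card S = k then \<Prod>j\<in>S. z j else 0)"
    by (simp add: coeff_sum)
  also have "\<dots> = elem_sym n k z"
    unfolding elem_sym_def by (subst sum.inter_filter [symmetric]) simp_all
  finally show ?thesis .
qed

lemma coeff_form_zero_extend:
  "coeff_form n (zero_extend \<mu>) p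
     = (\<Sum>j = 0..n. \<Sum>i = 0..j. \<mu> (j - i) * coeff p i * coeff p j)"
proof -
  have "(\<Sum>i = 0..n. zero_extend \<mu> (int j - int i) * coeff p i)
      = (\<Sum>i = 0..j. \<mu> (j - i) * coeff p i)" if "j \<in> {0..n}" for j
  proof -
    have "(\<Sum>i = 0..n. zero_extend \<mu> (int j - int i) * coeff p i)
        = (\<Sum>i = 0..j. zero_extend \<mu> (int j - int i) * coeff p i)"
      using that by (intro sum.mono_neutral_right) (auto simp: zero_extend_def)
    also have "\<dots> = (\<Sum>i = 0..j. \<mu> (j - i) * coeff p i)"
      by (intro sum.cong refl) (auto simp: zero_extend_def nat_diff_distrib)
    finally show ?thesis .
  qed
  then show ?thesis
    by (simp add: coeff_form_def sum_distrib_right)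
qed

lemma W_fun_eq_coeff_form: "W_fun \<mu> n z = coeff_form n (zero_extend \<mu>) (\<Prod>j = 1..n. [:1, z j:])"
  by (simp only: coeff_form_zero_extend W_fun_def coeff_prod_linear)

lemma W_fun_eq_polarization:
  assumes "\<And>j. j \<in> {1..n} \<Longrightarrow> z j \<noteq> 0"
  shows "W_fun \<mu> n z = (\<Prod>j = 1..n. z j) * polarization n (gamma_seq \<mu>) (\<lambda>j. z j + 1 / z j)"
proof -
  have "gamma_seq \<mu> = (\<lambda>k. (neighbour_sum ^^ k) (zero_extend \<mu>) 0)"
    by (simp add: fun_eq_iff gamma_seq_eq_funpow)
  then show ?thesis
    using coeff_form_prod [OF assms] by (simp only: W_fun_eq_coeff_form)
qed

text \<open>Since \<open>z ^ (i + j)\<close> splits as \<open>z ^ i * z ^ j\<close>, evaluation at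
  \<open>z\<close> only rescales the coefficients, passing from \<open>p(t)\<close> to
  \<open>p(z t)\<close>.\<close>

lemma poly_T_op:
  assumes "degree p \<le> n"
  shows "poly (T_op \<mu> p) z = coeff_form n (zero_extend \<mu>) (p \<circ>\<^sub>p monom z 1)"
proof -
  have "poly (T_op \<mu> p) z
      = (\<Sum>j = 0..degree p. \<Sum>i = 0..j. \<mu> (j - i) * (z ^ i * coeff p i) * (z ^ j * coeff p j))"
    by (simp add: T_op_def poly_sum poly_monom power_add mult_ac)
  also have "\<dots> = (\<Sum>j = 0..n. \<Sum>i = 0..j. \<mu> (j - i) * (z ^ i * coeff p i) * (z ^ j * coeff p j))"
    using assms by (intro sum.mono_neutral_left) (auto simp: coeff_eq_0 intro!: sum.neutral)
  finally show ?thesis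
    by (simp add: coeff_form_zero_extend)
qed

lemma coeff_form_smult: "coeff_form n \<nu> (smult c p) = c\<^sup>2 * coeff_form n \<nu> p"
  by (simp add: coeff_form_def sum_distrib_left sum_distrib_right power2_eq_square mult_ac)

lemma poly_T_op_one_plus_power: "poly (T_op \<mu> ([:1, 1:] ^ n)) z = W_fun \<mu> n (\<lambda>_. z)"
proof -
  have "[:1, 1:] ^ n \<circ>\<^sub>p monom z 1 = (\<Prod>j = 1..n. [:1, z:])"
    using pcompose_prod [of "\<lambda>_. [:1, 1:]" "{1..n}" "monom z 1"]
    by (simp add: pcompose_pCons monom_altdef)
  then show ?thesis
    using degree_power_le [of "[:1, 1:] :: complex poly" n]
    by (simp add: poly_T_op W_fun_eq_coeff_form)
qed

section \<open>Polynomials with non-positive zeros\<close>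

text \<open>Roots are split off one by one as \<open>t - \<zeta>\<close> with
  \<open>- \<zeta>\<close> real and nonnegative. Allowing \<open>b j = 0\<close> makes the number of
  factors exactly \<open>n\<close>.\<close>

lemma real_nonpos_zeros_imp_prod_linear:
  fixes p :: "complex poly"
  assumes "degree p \<le> n" "\<And>z. poly p z = 0 \<Longrightarrow> z \<in> \<real> \<and> Re z \<le> 0"
  shows "\<exists>c a b. c \<noteq> 0 \<and> (\<forall>j. a j \<ge> 0 \<and> b j \<ge> (0 :: real))
           \<and> p = smult c (\<Prod>j = 1..n. [:of_real (a j), of_real (b j):])"
  using assms
proof (induction n arbitrary: p)
  case 0
  then obtain c where c: "p = [:c:]"
    using degree_eq_zeroE by (metis le_zero_eq)
  have "poly p 1 \<noteq> 0"
    using "0.prems"(2) [of 1] by auto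
  then have "c \<noteq> 0" by (simp add: c)
  then show ?case
    by (intro exI [of _ c] exI [of _ "\<lambda>_. 0"]) (simp add: c)
next
  case (Suc n)
  \<comment> \<open>The zero polynomial is excluded, as it vanishes at the positive point 1.\<close>
  have p0: "p \<noteq> 0"
    using Suc.prems(2) [of 1] by auto
  have "\<exists>q a b. p = [:of_real a, of_real b:] * q \<and> degree q \<le> n \<and> a \<ge> 0 \<and> b \<ge> (0 :: real)"
  proof (cases "degree p = 0")
    case True
    \<comment> \<open>No root is left, so the trivial factor 1 fills the slot.\<close>
    then have "p = [:of_real 1, of_real 0:] * p" "degree p \<le> n" by simp_all
    then show ?thesis
      by (intro exI [of _ p] exI [of _ "1 :: real"] exI [of _ "0 :: real"]) simp
  next
    case False
    then have "\<not> constant (poly p)" by (simp add: constant_degree)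
    then obtain \<zeta> where \<zeta>: "poly p \<zeta> = 0"
      using fundamental_theorem_of_algebra by blast
    then obtain q where q: "p = [:- \<zeta>, 1:] * q"
      by (metis poly_eq_0_iff_dvd dvdE)
    have "- \<zeta> = of_real (- Re \<zeta>)"
      using Suc.prems(2) [OF \<zeta>] by (simp add: of_real_Re)
    with q have "p = [:of_real (- Re \<zeta>), of_real 1:] * q" by simp
    moreover have "degree p = degree [:- \<zeta>, 1:] + degree q"
      using p0 unfolding q by (intro degree_mult_eq) auto
    ultimately show ?thesis
      using Suc.prems(1) Suc.prems(2) [OF \<zeta>]
      by (intro exI [of _ q] exI [of _ "- Re \<zeta>"] exI [of _ "1 :: real"]) simp
  qed
  then obtain q a b where q: "p = [:of_real a, of_real b:] * q" "degree q \<le> n" "a \<ge> 0" "b \<ge> (0 :: real)"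
    by blast
  have "z \<in> \<real> \<and> Re z \<le> 0" if "poly q z = 0" for z
    using Suc.prems(2) [of z] that by (simp add: q(1))
  from Suc.IH [OF q(2) this] obtain c a' b' where
    c: "c \<noteq> 0" "\<forall>j. a' j \<ge> 0 \<and> b' j \<ge> (0 :: real)"
       "q = smult c (\<Prod>j = 1..n. [:of_real (a' j), of_real (b' j):])"
    by blast
  have "p = smult c (\<Prod>j = 1..Suc n. [:of_real ((a'(Suc n := a)) j), of_real ((b'(Suc n := b)) j):])"
    by (simp add: q(1) c(3))
  with c(1,2) q(3,4) show ?case
    by (intro exI [of _ c] exI [of _ "a'(Suc n := a)"] exI [of _ "b'(Suc n := b)"]) auto
qed

text \<open>Positive ratios \<open>b j / a j\<close> keep the arguments of W in the right half
  plane; the constants come out squared because T is quadratic.\<close>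

lemma T_op_prod_positive_nonzero:
  fixes a b :: "nat \<Rightarrow> real"
  assumes "weakly_hurwitz_stable n (W_fun \<mu> n)" "c \<noteq> 0"
    and "\<And>j. a j > 0" "\<And>j. b j > 0" "Re z > 0"
  shows "poly (T_op \<mu> (smult c (\<Prod>j = 1..n. [:of_real (a j), of_real (b j):]))) z \<noteq> 0"
proof -
  let ?w = "\<lambda>j. of_real (b j / a j) * z"
  have ne: "a j \<noteq> 0" for j
    using assms(3) [of j] by simp
  have "(\<Prod>j = 1..n. [:of_real (a j), of_real (b j):]) \<circ>\<^sub>p monom z 1
      = (\<Prod>j = 1..n. smult (of_real (a j)) [:1, ?w j:])"
    by (simp add: pcompose_prod pcompose_pCons monom_altdef ne mult.commute)
  also have "\<dots> = smult (\<Prod>j = 1..n. of_real (a j)) (\<Prod>j = 1..n. [:1, ?w j:])"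
    by (rule prod_smult)
  finally have "poly (T_op \<mu> (smult c (\<Prod>j = 1..n. [:of_real (a j), of_real (b j):]))) z
      = (c * (\<Prod>j = 1..n. of_real (a j)))\<^sup>2 * W_fun \<mu> n ?w"
    using degree_prod_linear_le [of "\<lambda>j. of_real (a j)" "\<lambda>j. of_real (b j)" n]
    by (simp add: poly_T_op [of _ n] pcompose_smult coeff_form_smult W_fun_eq_coeff_form
        power_mult_distrib del: smult_smult)
  moreover have "W_fun \<mu> n ?w \<noteq> 0"
    using assms(1,3-5) by (simp add: weakly_hurwitz_stable_def)
  ultimately show ?thesis
    using assms(2) ne by simp
qed

section \<open>Limits of products of linear factors and Hurwitz's theorem\<close>

lemma tendsto_coeff_prod_linear:
  fixes a b :: "nat \<Rightarrow> nat \<Rightarrow> complex"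
  assumes "\<And>j. (\<lambda>k. a k j) \<longlonglongrightarrow> a' j" "\<And>j. (\<lambda>k. b k j) \<longlonglongrightarrow> b' j"
  shows "(\<lambda>k. coeff (\<Prod>j = 1..n. [:a k j, b k j:]) i) \<longlonglongrightarrow> coeff (\<Prod>j = 1..n. [:a' j, b' j:]) i"
proof (induction n arbitrary: i)
  case (Suc n)
  show ?case
    using Suc.IH assms
    by (cases i) (auto intro!: tendsto_intros)
qed simp

lemma uniform_limit_finite_sum:
  fixes f :: "'i \<Rightarrow> 'n \<Rightarrow> 'a \<Rightarrow> 'b::real_normed_vector"
  assumes "\<And>i. i \<in> I \<Longrightarrow> uniform_limit K (f i) (g i) F"
  shows "uniform_limit K (\<lambda>k z. \<Sum>i\<in>I. f i k z) (\<lambda>z. \<Sum>i\<in>I. g i z) F"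
  using assms
  by (induction I rule: infinite_finite_induct)
     (auto intro: uniform_limit_const uniform_limit_add)

lemma uniform_limit_poly_T_op:
  assumes "\<And>i. (\<lambda>k. coeff (q k) i) \<longlonglongrightarrow> coeff p i" "\<And>k. degree (q k) \<le> n" "degree p \<le> n"
    and "compact K"
  shows "uniform_limit K (\<lambda>k. poly (T_op \<mu> (q k))) (poly (T_op \<mu> p)) sequentially"
proof -
  \<comment> \<open>The common bound \<open>n\<close> gives all sums the same shape, whatever the
    degrees of \<open>q k\<close> and \<open>p\<close>.\<close>
  define F where "F r z = (\<Sum>j = 0..n. \<Sum>i = 0..j. \<mu> (j - i) * coeff r i * coeff r j * z ^ (i + j))"
    for r z
  have F: "poly (T_op \<mu> r) = F r" if "degree r \<le> n" for r
    by (simp add: fun_eq_iff poly_T_op [OF that] coeff_form_zero_extend F_def power_add mult_ac)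
  have "uniform_limit K (\<lambda>k z. \<mu> (j - i) * coeff (q k) i * coeff (q k) j * z ^ (i + j))
      (\<lambda>z. \<mu> (j - i) * coeff p i * coeff p j * z ^ (i + j)) sequentially" for i j
  proof (rule uniform_lim_mult)
    have "(\<lambda>k. \<mu> (j - i) * coeff (q k) i * coeff (q k) j) \<longlonglongrightarrow> \<mu> (j - i) * coeff p i * coeff p j"
      by (intro tendsto_intros assms)
    then show "uniform_limit K (\<lambda>k z. \<mu> (j - i) * coeff (q k) i * coeff (q k) j)
        (\<lambda>z. \<mu> (j - i) * coeff p i * coeff p j) sequentially"
      unfolding tendsto_iff uniform_limit_iff by (auto elim!: eventually_mono)
    have "compact ((\<lambda>z. z ^ (i + j)) ` K)"
      by (intro compact_continuous_image continuous_intros assms)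
    then show "bounded ((\<lambda>z. z ^ (i + j)) ` K)"
      by (rule compact_imp_bounded)
    show "bounded ((\<lambda>z. \<mu> (j - i) * coeff p i * coeff p j) ` K)"
      by (rule bounded_subset [of "{\<mu> (j - i) * coeff p i * coeff p j}"]) auto
  qed (rule uniform_limit_const)
  then have "uniform_limit K (\<lambda>k. F (q k)) (F p) sequentially"
    unfolding F_def [abs_def] by (intro uniform_limit_finite_sum)
  then show ?thesis
    using assms(2,3) by (simp add: F)
qed

lemma weakly_hurwitz_stable_poly_iff:
  "weakly_hurwitz_stable_poly p \<longleftrightarrow> (\<forall>z. Re z > 0 \<longrightarrow> poly p z \<noteq> 0)"
  unfolding weakly_hurwitz_stable_poly_def weakly_hurwitz_stable_def by fastforce

lemma poly_eq_0_if_zero_on_right_half_plane: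
  fixes p :: "complex poly"
  assumes "\<And>z. Re z > 0 \<Longrightarrow> poly p z = 0"
  shows "p = 0"
proof (rule ccontr)
  assume "p \<noteq> 0"
  then have "finite {z. poly p z = 0}" by (rule poly_roots_finite)
  moreover have "range (\<lambda>k. complex_of_nat (Suc k)) \<subseteq> {z. poly p z = 0}"
    using assms by auto
  ultimately have "finite (range (\<lambda>k. complex_of_nat (Suc k)))"
    by (rule finite_subset [rotated])
  moreover have "inj (\<lambda>k. complex_of_nat (Suc k))"
    by (intro injI) (simp only: of_nat_eq_iff Suc_inject)
  ultimately show False
    using finite_imageD infinite_UNIV_nat by blast
qed

lemma T_op_zero_or_stable:
  assumes "weakly_hurwitz_stable n (W_fun \<mu> n)" "degree p \<le> n"
    and "\<And>z. poly p z = 0 \<Longrightarrow> z \<in> \<real> \<and> Re z \<le> 0"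
  shows "T_op \<mu> p = 0 \<or> weakly_hurwitz_stable_poly (T_op \<mu> p)"
proof -
  obtain c and a b :: "nat \<Rightarrow> real" where c: "c \<noteq> 0" and ab: "\<And>j. a j \<ge> 0" "\<And>j. b j \<ge> 0"
    and p: "p = smult c (\<Prod>j = 1..n. [:of_real (a j), of_real (b j):])"
    using real_nonpos_zeros_imp_prod_linear [OF assms(2,3)] by metis
  \<comment> \<open>Adding \<open>e k\<close> makes all \<open>a j\<close> and \<open>b j\<close>
    strictly positive, so that W can be evaluated at the ratios.\<close>
  define e where "e k = inverse (real (Suc k))" for k
  have e: "e k > 0" "e \<longlonglongrightarrow> 0" for k
    using LIMSEQ_inverse_real_of_nat by (simp_all add: e_def [abs_def])
  define q where "q k = smult c (\<Prod>j = 1..n. [:of_real (a j + e k), of_real (b j + e k):])" for k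
  have lim: "(\<lambda>k. complex_of_real (x + e k)) \<longlonglongrightarrow> of_real x" for x
    using tendsto_add [OF tendsto_const e(2), of x] by (intro tendsto_of_real) simp
  have coeff_lim: "(\<lambda>k. coeff (q k) i) \<longlonglongrightarrow> coeff p i" for i
    unfolding p q_def coeff_smult
    by (intro tendsto_mult tendsto_const tendsto_coeff_prod_linear lim)
  have deg: "degree (q k) \<le> n" for k
    unfolding q_def by (rule order.trans [OF degree_smult_le degree_prod_linear_le])
  let ?H = "{z. Re z > 0}"
  have nz: "poly (T_op \<mu> (q k)) z \<noteq> 0" if "z \<in> ?H" for k z
    unfolding q_def using assms(1) c that ab e(1)
    by (intro T_op_prod_positive_nonzero) (auto intro: add_nonneg_pos)
  show ?thesis
  \<comment> \<open>Hurwitz's theorem asks for a nonconstant limit. A constant limit is either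
    nonzero, hence stable, or zero, which is the first alternative.\<close>
  proof (cases "poly (T_op \<mu> p) constant_on ?H")
    case True
    then obtain d where d: "\<And>z. Re z > 0 \<Longrightarrow> poly (T_op \<mu> p) z = d"
      by (auto simp: constant_on_def)
    then show ?thesis
      using poly_eq_0_if_zero_on_right_half_plane [of "T_op \<mu> p"]
      by (cases "d = 0") (auto simp: weakly_hurwitz_stable_poly_iff)
  next
    case False
    have "poly (T_op \<mu> p) z \<noteq> 0" if "z \<in> ?H" for z
    proof (rule Hurwitz_no_zeros [of ?H "\<lambda>k. poly (T_op \<mu> (q k))" "poly (T_op \<mu> p)"])
      show "open ?H" by (rule open_halfspace_Re_gt)
      show "connected ?H" by (intro convex_connected convex_halfspace_Re_gt)
      show "uniform_limit K (\<lambda>k. poly (T_op \<mu> (q k))) (poly (T_op \<mu> p)) sequentially"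
        if "compact K" "K \<subseteq> ?H" for K
        using coeff_lim deg assms(2) that(1) by (rule uniform_limit_poly_T_op)
    qed (use False nz that in \<open>auto intro!: holomorphic_intros\<close>)
    then show ?thesis by (simp add: weakly_hurwitz_stable_poly_iff)
  qed
qed

section \<open>The equivalences\<close>

lemma Re_add_inverse_pos: "Re z > 0 \<Longrightarrow> Re (z + 1 / z) > 0"
  by (simp add: Re_divide add_pos_nonneg)

text \<open>The roots of \<open>z\<^sup>2 - w z + 1\<close> are \<open>z\<close> and \<open>1/z\<close>, whose real parts have the same sign.\<close>

lemma add_inverse_surj_right_half_plane:
  fixes w :: complex
  assumes "Re w > 0"
  obtains z where "Re z > 0" "w = z + 1 / z"
proof -
  define z where "z = (w + csqrt (w\<^sup>2 - 4)) / 2"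
  have "2 * z - w = csqrt (w\<^sup>2 - 4)"
    by (simp add: z_def del: distrib_left_numeral)
  then have "(2 * z - w)\<^sup>2 = w\<^sup>2 - 4" by simp
  then have "4 * (z * (w - z)) = 4 * 1"
    by (simp add: power2_eq_square algebra_simps)
  then have eq: "z * (w - z) = 1"
    by (simp only: mult_cancel_left) simp
  then have "z \<noteq> 0" by auto
  with eq have w: "w = z + 1 / z" by (simp add: field_simps)
  \<comment> \<open>The second factor is positive, so \<open>Re z\<close> has the sign of
    \<open>Re w\<close> whichever root \<open>csqrt\<close> selects.\<close>
  have "Re w = Re z * (1 + 1 / ((Re z)\<^sup>2 + (Im z)\<^sup>2))"
    by (simp add: w Re_divide algebra_simps)
  moreover have "1 + 1 / ((Re z)\<^sup>2 + (Im z)\<^sup>2) > 0"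
    by (simp add: add_pos_nonneg)
  ultimately have "Re z > 0"
    using assms by (simp add: zero_less_mult_iff)
  then show ?thesis using w that by blast
qed

lemma W_fun_diagonal:
  assumes "z \<noteq> 0"
  shows "W_fun \<mu> n (\<lambda>_. z) = z ^ n * poly (P_poly \<mu> n) (z + 1 / z)"
  using assms by (simp add: W_fun_eq_polarization polarization_diagonal P_poly_eq_binomial_poly)

text \<open>The system is unitriangular: \<open>gamma_seq \<mu> k\<close> is \<open>\<mu> k\<close>
  plus terms in \<open>\<mu>\<close> at smaller indices.\<close>

lemma gamma_seq_eq_0_imp:
  assumes "\<And>k. k \<le> n \<Longrightarrow> gamma_seq \<mu> k = 0" "k \<le> n"
  shows "\<mu> k = 0"
  using assms(2)
proof (induction k rule: less_induct)
  case (less k)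
  have "gamma_seq \<mu> k = \<mu> k + (\<Sum>j = 1..k div 2. of_nat (k choose j) * \<mu> (k - 2 * j))"
    unfolding gamma_seq_def by (simp add: sum.atLeast_Suc_atMost)
  also have "(\<Sum>j = 1..k div 2. of_nat (k choose j) * \<mu> (k - 2 * j)) = 0"
    using less by (intro sum.neutral) auto
  finally show ?case using assms(1) less.prems by simp
qed

lemma P_poly_eq_0_imp:
  assumes "P_poly \<mu> n = 0" "k \<le> n"
  shows "\<mu> k = 0"
proof (rule gamma_seq_eq_0_imp [OF _ assms(2)])
  fix k assume "k \<le> n"
  have "coeff (P_poly \<mu> n) (n - k)
      = (\<Sum>i = 0..n. if i = k then gamma_seq \<mu> i * of_nat (n choose i) else 0)"
    unfolding P_poly_def coeff_sum using \<open>k \<le> n\<close> by (intro sum.cong) auto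
  also have "\<dots> = gamma_seq \<mu> k * of_nat (n choose k)"
    using \<open>k \<le> n\<close> by simp
  finally show "gamma_seq \<mu> k = 0"
    using assms(1) \<open>k \<le> n\<close> by (simp add: binomial_eq_0_iff)
qed

section \<open>The implications between the stability conditions\<close>

lemma stable_W_fun_imp_stable_T_op:
  assumes "weakly_hurwitz_stable n (W_fun \<mu> n)"
  shows "weakly_hurwitz_stable_poly (T_op \<mu> ([:1, 1:] ^ n))"
  using assms
  by (simp add: weakly_hurwitz_stable_def weakly_hurwitz_stable_poly_iff poly_T_op_one_plus_power)

lemma stable_T_op_imp_stable_P_poly:
  assumes "weakly_hurwitz_stable_poly (T_op \<mu> ([:1, 1:] ^ n))"
  shows "weakly_hurwitz_stable_poly (P_poly \<mu> n)"
  unfolding weakly_hurwitz_stable_poly_iff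
proof (intro allI impI)
  fix w assume "Re w > 0"
  then obtain z where z: "Re z > 0" "w = z + 1 / z"
    by (rule add_inverse_surj_right_half_plane)
  then have "z \<noteq> 0" by auto
  with z assms show "poly (P_poly \<mu> n) w \<noteq> 0"
    by (auto simp: weakly_hurwitz_stable_poly_iff poly_T_op_one_plus_power W_fun_diagonal)
qed

lemma stable_P_poly_imp_stable_W_fun:
  assumes "weakly_hurwitz_stable_poly (P_poly \<mu> n)"
  shows "weakly_hurwitz_stable n (W_fun \<mu> n)"
  unfolding weakly_hurwitz_stable_def
proof (intro allI impI)
  fix z :: "nat \<Rightarrow> complex" assume z: "\<forall>j\<in>{1..n}. Re (z j) > 0"
  then have nz: "z j \<noteq> 0" if "j \<in> {1..n}" for j
    using that by fastforce
  have "polarization n (gamma_seq \<mu>) (\<lambda>j. z j + 1 / z j) \<noteq> 0"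
    using assms z Re_add_inverse_pos
    by (intro Grace_Walsh_Szego_right_half_plane)
       (auto simp: weakly_hurwitz_stable_poly_iff P_poly_eq_binomial_poly)
  then show "W_fun \<mu> n z \<noteq> 0"
    using nz by (subst W_fun_eq_polarization) auto
qed

text \<open>This rules out the zero alternative of (ii) for \<open>(1 + z)^n\<close>: if T vanishes
  there, then P vanishes on the right half plane, hence identically.\<close>

lemma T_op_one_plus_power_eq_0_imp:
  assumes "T_op \<mu> ([:1, 1:] ^ n) = 0" "k \<le> n"
  shows "\<mu> k = 0"
proof (rule P_poly_eq_0_imp [OF _ assms(2)])
  show "P_poly \<mu> n = 0"
  proof (rule poly_eq_0_if_zero_on_right_half_plane)
    fix w assume "Re w > 0"
    then obtain z where z: "Re z > 0" "w = z + 1 / z"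
      by (rule add_inverse_surj_right_half_plane)
    then have "z \<noteq> 0" by auto
    then show "poly (P_poly \<mu> n) w = 0"
      using poly_T_op_one_plus_power [of \<mu> n z] assms(1) z(2) by (simp add: W_fun_diagonal)
  qed
qed

theorem theorem3p2:
  fixes n :: nat and \<mu> :: "nat \<Rightarrow> complex"
  assumes "n \<ge> 1"
  shows "(weakly_hurwitz_stable n (W_fun \<mu> n)
            \<longleftrightarrow> weakly_hurwitz_stable_poly (T_op \<mu> ([:1, 1:] ^ n)))
       \<and> (\<forall>z. poly (T_op \<mu> ([:1, 1:] ^ n)) z = W_fun \<mu> n (\<lambda>_. z))
       \<and> (weakly_hurwitz_stable n (W_fun \<mu> n)
            \<longleftrightarrow> weakly_hurwitz_stable_poly (P_poly \<mu> n))
       \<and> ((\<exists>k\<le>n. \<mu> k \<noteq> 0) \<longrightarrow>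
           (weakly_hurwitz_stable n (W_fun \<mu> n)
            \<longleftrightarrow> (\<forall>p :: complex poly.
                   degree p \<le> n \<and> (\<forall>z. poly p z = 0 \<longrightarrow> z \<in> \<real> \<and> Re z \<le> 0) \<longrightarrow>
                   T_op \<mu> p = 0 \<or> weakly_hurwitz_stable_poly (T_op \<mu> p))))"
proof -
  \<comment> \<open>Condition (ii) is tested at \<open>(1 + z)^n\<close>. If \<open>\<mu>\<close>
    vanished up to \<open>n\<close>, then (ii) would hold through \<open>T_op \<mu> p = 0\<close>,
    while W would be 0 and so not stable; hence the assumption of a nonzero
    \<open>\<mu> k\<close>.\<close>
  have "weakly_hurwitz_stable_poly (T_op \<mu> ([:1, 1:] ^ n))"
    if "\<exists>k\<le>n. \<mu> k \<noteq> 0"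
      and ii: "\<forall>p :: complex poly.
        degree p \<le> n \<and> (\<forall>z. poly p z = 0 \<longrightarrow> z \<in> \<real> \<and> Re z \<le> 0) \<longrightarrow>
        T_op \<mu> p = 0 \<or> weakly_hurwitz_stable_poly (T_op \<mu> p)"
  proof -
    have "z \<in> \<real> \<and> Re z \<le> 0" if "poly ([:1, 1:] ^ n) z = 0" for z :: complex
    proof -
      have "z = - 1"
        using that by (simp add: add_eq_0_iff)
      then show ?thesis by simp
    qed
    moreover have "degree ([:1, 1:] ^ n :: complex poly) \<le> n"
      using degree_power_le [of "[:1, 1:] :: complex poly" n] by simp
    ultimately have "T_op \<mu> ([:1, 1:] ^ n) = 0 \<or> weakly_hurwitz_stable_poly (T_op \<mu> ([:1, 1:] ^ n))"
      using ii by blast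
    then show ?thesis
      using that(1) T_op_one_plus_power_eq_0_imp by blast
  qed
  \<comment> \<open>The implications (i) to (iii) to (iv) to (i) close a cycle; (ii) follows from
    (i) and leads back to (iii).\<close>
  then show ?thesis
    using stable_W_fun_imp_stable_T_op stable_T_op_imp_stable_P_poly
      stable_P_poly_imp_stable_W_fun T_op_zero_or_stable poly_T_op_one_plus_power
    by metis
qed

end
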